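(* There exists a sequence $\{D_k\}_{k=1}^{\infty}$ of oriented complete bipartite graphs satisfying $\gamma_0(D_k)>k$ for every $k\ge 1$.
   Context: An oriented complete bipartite graph is a finite digraph obtained from a complete bipartite graph, with nonempty partite classes $A$ and $B$, by giving each edge exactly one of its two orientations. For a bipartite digraph $D$ with partite classes $A$ and $B$, $\gamma_A(D)$ denotes the minimum number of vertices in $A$ that dominate $B$, i.e. the minimum size of a set $U\subseteq A$ such that for every $b\in B$ there is $u\in U$ with $(u,b)\in E(D)$; similarly $\gamma_B(D)$ denotes the minimum number of vertices in $B$ dominating $A$ (with value $\infty$ if no such set exists). $\gamma_0(D)=\min\{\gamma_A(D),\gamma_B(D)\}$. *)

theory Defs
  imports "Graph_Theory.Pair_Digraph" "HOL-Library.Extended_Nat"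
begin

definition bipartite_digraph :: "'a pair_pre_digraph \<Rightarrow> 'a set \<Rightarrow> 'a set \<Rightarrow> bool" where
  "bipartite_digraph D A B \<longleftrightarrow>
     pair_fin_digraph D \<and> pverts D = A \<union> B \<and> A \<inter> B = {} \<and>
     parcs D \<subseteq> (A \<times> B) \<union> (B \<times> A)"

definition oriented_complete_bipartite ::
  "'a pair_pre_digraph \<Rightarrow> 'a set \<Rightarrow> 'a set \<Rightarrow> bool" where
  "oriented_complete_bipartite D A B \<longleftrightarrow>
     bipartite_digraph D A B \<and> A \<noteq> {} \<and> B \<noteq> {} \<and>
     (\<forall>a\<in>A. \<forall>b\<in>B. ((a, b) \<in> parcs D) \<noteq> ((b, a) \<in> parcs D))"

definition dominates_class :: "'a pair_pre_digraph \<Rightarrow> 'a set \<Rightarrow> 'a set \<Rightarrow> bool" where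
  "dominates_class D U B \<longleftrightarrow> (\<forall>b\<in>B. \<exists>u\<in>U. (u, b) \<in> parcs D)"

text \<open>The infimum in \<^typ>\<open>enat\<close> is a minimum when a dominating set exists, and is
  \<open>\<infinity>\<close> otherwise. For a digraph \<open>D\<close> with partite classes \<open>A\<close> and \<open>B\<close>, the paper's
  \<open>\<gamma>\<^sub>A(D)\<close> is \<open>class_domination_number D A B\<close> and \<open>\<gamma>\<^sub>B(D)\<close> is
  \<open>class_domination_number D B A\<close>.\<close>

definition class_domination_number ::
  "'a pair_pre_digraph \<Rightarrow> 'a set \<Rightarrow> 'a set \<Rightarrow> enat" where
  "class_domination_number D A B =
     Inf {enat (card U) | U. U \<subseteq> A \<and> finite U \<and> dominates_class D U B}"

definition gamma0 :: "'a pair_pre_digraph \<Rightarrow> 'a set \<Rightarrow> 'a set \<Rightarrow> enat" where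
  "gamma0 D A B = min (class_domination_number D A B) (class_domination_number D B A)"

end

theory Submission
  imports Defs "HOL-Library.Nat_Bijection"
begin

text \<open>
  Fix \<open>k\<close>. Let one class consist of \<open>k\<^sup>2 + 1\<close> points and the other of all sets of at most \<open>k\<close> of
  these points, and orient the edge between a point \<open>a\<close> and a set \<open>S\<close> from \<open>a\<close> to \<open>S\<close> if
  \<open>a \<notin> S\<close> and from \<open>S\<close> to \<open>a\<close> if \<open>a \<in> S\<close>.

  At most \<open>k\<close> points never dominate all sets: the points of \<open>U\<close> form a set \<open>U\<close> that is itself a
  vertex, and none of them sends an arc to it. At most \<open>k\<close> sets never dominate all points: a
  dominating family would cover the points, but \<open>k\<close> sets of size at most \<open>k\<close> cover at most
  \<open>k\<^sup>2\<close> of them.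

  To have natural numbers as vertices, a point \<open>a\<close> becomes the even number \<open>2 * a\<close> and a set
  becomes an odd number, by way of the binary encoding of finite sets of naturals.
\<close>

definition set_vertex :: "nat set \<Rightarrow> nat" where
  "set_vertex S = Suc (2 * set_encode S)"

definition points :: "nat \<Rightarrow> nat set" where
  "points k = {..k * k}"

definition small_sets :: "nat \<Rightarrow> nat set set" where
  "small_sets k = {S. S \<subseteq> points k \<and> card S \<le> k}"

definition point_class :: "nat \<Rightarrow> nat set" where
  "point_class k = (*) 2 ` points k"

definition set_class :: "nat \<Rightarrow> nat set" where
  "set_class k = set_vertex ` small_sets k"

definition membership_digraph :: "nat \<Rightarrow> nat pair_pre_digraph" where
  "membership_digraph k =
     \<lparr>pverts = point_class k \<union> set_class k,
      parcs = {(2 * a, set_vertex S) | a S. a \<in> points k \<and> S \<in> small_sets k \<and> a \<notin> S} \<union>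
              {(set_vertex S, 2 * a) | a S. a \<in> points k \<and> S \<in> small_sets k \<and> a \<in> S}\<rparr>"

lemma finite_points: "finite (points k)"
  by (simp add: points_def)

lemma finite_small_sets: "finite (small_sets k)"
  by (rule finite_subset[of _ "Pow (points k)"]) (auto simp: small_sets_def finite_points)

lemma small_setD:
  assumes "S \<in> small_sets k"
  shows "finite S" "card S \<le> k"
  using assms finite_subset[OF _ finite_points] by (auto simp: small_sets_def)

lemma set_vertex_eq_iff:
  "S \<in> small_sets k \<Longrightarrow> T \<in> small_sets k \<Longrightarrow> set_vertex S = set_vertex T \<longleftrightarrow> S = T"
  by (simp add: set_vertex_def set_encode_eq small_setD)

lemma set_vertex_neq_even: "set_vertex S \<noteq> 2 * a" "2 * a \<noteq> set_vertex S"
  unfolding set_vertex_def by presburger+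

lemma arc_from_point_iff:
  assumes "a \<in> points k" "S \<in> small_sets k"
  shows "(2 * a, set_vertex S) \<in> parcs (membership_digraph k) \<longleftrightarrow> a \<notin> S"
  using assms by (auto simp: membership_digraph_def set_vertex_neq_even set_vertex_eq_iff)

lemma arc_from_set_iff:
  assumes "a \<in> points k" "S \<in> small_sets k"
  shows "(set_vertex S, 2 * a) \<in> parcs (membership_digraph k) \<longleftrightarrow> a \<in> S"
  using assms by (auto simp: membership_digraph_def set_vertex_neq_even set_vertex_eq_iff)

lemma oriented_complete_bipartite_membership_digraph:
  "oriented_complete_bipartite (membership_digraph k) (point_class k) (set_class k)"
proof -
  let ?D = "membership_digraph k" and ?A = "point_class k" and ?B = "set_class k"
  have arcs: "parcs ?D \<subseteq> ?A \<times> ?B \<union> ?B \<times> ?A"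
    by (auto simp: membership_digraph_def point_class_def set_class_def)
  have verts: "pverts ?D = ?A \<union> ?B"
    by (simp add: membership_digraph_def)
  have fin: "finite ?A" "finite ?B"
    by (simp_all add: point_class_def set_class_def finite_points finite_small_sets)
  have "pair_fin_digraph ?D"
  proof
    show "finite (pverts ?D)"
      using fin verts by simp
    show "finite (parcs ?D)"
      by (rule finite_subset[OF arcs]) (simp add: fin)
  qed (use arcs verts in auto)
  moreover have "?A \<inter> ?B = {}"
    by (auto simp: point_class_def set_class_def set_vertex_neq_even)
  moreover have "?A \<noteq> {}" "?B \<noteq> {}"
    by (auto simp: point_class_def set_class_def points_def small_sets_def intro: exI[of _ "{}"])
  moreover have "((a, b) \<in> parcs ?D) \<noteq> ((b, a) \<in> parcs ?D)" if "a \<in> ?A" "b \<in> ?B" for a b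
    using that by (auto simp: point_class_def set_class_def arc_from_point_iff arc_from_set_iff)
  ultimately show ?thesis
    using arcs verts by (simp add: oriented_complete_bipartite_def bipartite_digraph_def)
qed

text \<open>Passing to \<open>k + 1\<close> turns the strict bound into a lower bound for an infimum, so it also
  covers the case without any dominating set.\<close>

lemma less_class_domination_number:
  assumes "\<And>U. U \<subseteq> A \<Longrightarrow> finite U \<Longrightarrow> card U \<le> k \<Longrightarrow> \<not> dominates_class D U B"
  shows "enat k < class_domination_number D A B"
proof -
  have "enat (Suc k) \<le> class_domination_number D A B"
    unfolding class_domination_number_def using assms
    by (intro Inf_greatest) (auto simp flip: not_less_eq_eq)
  then show ?thesis
    by (simp add: Suc_ile_eq)
qed

text \<open>The obstruction to domination by a few points is the vertex that these points form as a
  set.\<close>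

lemma few_points_not_dominating:
  assumes "U \<subseteq> point_class k" "card U \<le> k"
  shows "\<not> dominates_class (membership_digraph k) U (set_class k)"
proof
  assume dom: "dominates_class (membership_digraph k) U (set_class k)"
  obtain P where P: "P \<subseteq> points k" and U: "U = (*) 2 ` P"
    using assms(1) by (auto simp: point_class_def subset_image_iff)
  have "card U = card P"
    unfolding U by (rule card_image) (simp add: inj_on_def)
  then have small: "P \<in> small_sets k"
    using P assms(2) by (simp add: small_sets_def)
  then obtain a where "a \<in> P" "(2 * a, set_vertex P) \<in> parcs (membership_digraph k)"
    using dom U by (auto simp: dominates_class_def set_class_def)
  then show False
    using P small arc_from_point_iff by blast
qed

text \<open>The point class has one element more than \<open>k\<close> sets of size \<open>k\<close> can cover.\<close>

lemma few_sets_not_dominating: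
  assumes "W \<subseteq> set_class k" "card W \<le> k"
  shows "\<not> dominates_class (membership_digraph k) W (point_class k)"
proof
  assume dom: "dominates_class (membership_digraph k) W (point_class k)"
  obtain F where F: "F \<subseteq> small_sets k" and W: "W = set_vertex ` F"
    using assms(1) by (auto simp: set_class_def subset_image_iff)
  have "card W = card F"
    unfolding W using F set_vertex_eq_iff by (intro card_image inj_onI) blast
  then have cardF: "card F \<le> k"
    using assms(2) by simp
  have finF: "finite F"
    using F finite_small_sets finite_subset by blast
  have cover: "points k \<subseteq> \<Union> F"
  proof
    fix a assume a: "a \<in> points k"
    then obtain S where "S \<in> F" "(set_vertex S, 2 * a) \<in> parcs (membership_digraph k)"
      using dom W by (auto simp: dominates_class_def point_class_def)
    then show "a \<in> \<Union> F"
      using F a arc_from_set_iff by blast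
  qed
  have "card (points k) \<le> card (\<Union> F)"
    using cover finF F by (intro card_mono) (auto dest: small_setD)
  also have "\<dots> \<le> (\<Sum>S\<in>F. card S)"
    by (rule card_Union_le_sum_card)
  also have "\<dots> \<le> card F * k"
    using sum_bounded_above[of F card k] F by (auto dest: small_setD)
  also have "\<dots> \<le> k * k"
    using cardF by simp
  finally show False
    by (simp add: points_def)
qed

theorem theorem13:
  "\<exists>(D :: nat \<Rightarrow> nat pair_pre_digraph) (A :: nat \<Rightarrow> nat set) (B :: nat \<Rightarrow> nat set).
     \<forall>k\<ge>1. oriented_complete_bipartite (D k) (A k) (B k) \<and>
            gamma0 (D k) (A k) (B k) > enat k"
proof (intro exI allI impI conjI)
  fix k :: nat
  show "oriented_complete_bipartite (membership_digraph k) (point_class k) (set_class k)"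
    by (rule oriented_complete_bipartite_membership_digraph)
  show "enat k < gamma0 (membership_digraph k) (point_class k) (set_class k)"
    by (simp add: gamma0_def less_class_domination_number
        few_points_not_dominating few_sets_not_dominating)
qed

end
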